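(* Let $\mathcal{H}$ be a real Hilbert space and let $T\colon\mathcal{H}\to\mathcal{H}$ be a nonexpansive operator such that the fixed-point set $\{x\in\mathcal{H}: x=Tx\}$ is nonempty. Let $\gamma>0$ and let $A\colon\mathcal{H}\to2^{\mathcal{H}}$ be a maximally monotone operator with $(\mathrm{Id}+\gamma A)^{-1}=\tfrac12\mathrm{Id}+\tfrac12T$ (such an $A$ exists). Let $\epsilon\in(0,1)$ and let $(\zeta_n)_{n\in\mathbb{N}}$ and $(\lambda_n)_{n\in\mathbb{N}}$ be real sequences with $0\le\zeta_n\le1-\epsilon$ and $\epsilon\le\lambda_n\le2-\frac{\epsilon}{2}$ for all $n\in\mathbb{N}$. Let $(x_n)_{n\in\mathbb{N}}$ be generated by the Krasnosel'skii--Mann iteration with deviations described in the context. Then $(x_n)_{n\in\mathbb{N}}$ converges weakly to a point $x\in\mathcal{H}$ with $x=Tx$.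
   Context: $\mathbb{N}=\{0,1,2,\dots\}$. $T$ is nonexpansive if $\|Tx-Ty\|\le\|x-y\|$ for all $x,y\in\mathcal{H}$. Algorithm (Krasnosel'skii--Mann iteration with deviations). Given $x_0\in\mathcal{H}$, set $v_0=0$. For $n=0,1,2,\dots$: $$p_n=\tfrac12(\mathrm{Id}+T)(x_n+v_n),$$ $$x_{n+1}=(1-\lambda_n)x_n+\lambda_n(p_n-v_n),$$ and then $v_{n+1}\in\mathcal{H}$ is chosen arbitrarily subject to $$\|v_{n+1}\|^2\le\zeta_n\frac{\lambda_n(2-\lambda_n)(2-\lambda_{n+1})}{\lambda_{n+1}}\left\|p_n-x_n+\frac{\lambda_n-1}{2-\lambda_n}v_n\right\|^2.$$ *)

theory Defs
  imports "HOL-Analysis.Analysis"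
begin

definition nonexpansive :: "('a::real_normed_vector \<Rightarrow> 'a) \<Rightarrow> bool" where
  "nonexpansive T \<longleftrightarrow> (\<forall>x y. norm (T x - T y) \<le> norm (x - y))"

definition monotone_op :: "('a::real_inner \<Rightarrow> 'a set) \<Rightarrow> bool" where
  "monotone_op A \<longleftrightarrow> (\<forall>x y. \<forall>u\<in>A x. \<forall>v\<in>A y. 0 \<le> (x - y) \<bullet> (u - v))"

text \<open>Maximality is with respect to inclusion of graphs.\<close>

definition maximally_monotone :: "('a::real_inner \<Rightarrow> 'a set) \<Rightarrow> bool" where
  "maximally_monotone A \<longleftrightarrow>
     monotone_op A \<and> (\<forall>B. monotone_op B \<and> (\<forall>x. A x \<subseteq> B x) \<longrightarrow> B = A)"

definition inverse_op :: "('a \<Rightarrow> 'b set) \<Rightarrow> 'b \<Rightarrow> 'a set" where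
  "inverse_op A y = {x. y \<in> A x}"

definition resolvent :: "real \<Rightarrow> ('a::real_vector \<Rightarrow> 'a set) \<Rightarrow> 'a \<Rightarrow> 'a set" where
  "resolvent \<gamma> A = inverse_op (\<lambda>x. {x + \<gamma> *\<^sub>R u | u. u \<in> A x})"

definition weakly_converges :: "(nat \<Rightarrow> 'a::real_inner) \<Rightarrow> 'a \<Rightarrow> bool" where
  "weakly_converges x l \<longleftrightarrow> (\<forall>u. (\<lambda>n. x n \<bullet> u) \<longlonglongrightarrow> l \<bullet> u)"

text \<open>
  The starting point \<open>x 0\<close> is unconstrained.  Each deviation \<open>v (Suc n)\<close> may be any vector
  satisfying the norm bound, so the iteration is a relation on sequences, not a recursion.
\<close>

definition km_iteration_with_deviations ::
  "('a::real_normed_vector \<Rightarrow> 'a) \<Rightarrow> (nat \<Rightarrow> real) \<Rightarrow> (nat \<Rightarrow> real) \<Rightarrow>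
   (nat \<Rightarrow> 'a) \<Rightarrow> (nat \<Rightarrow> 'a) \<Rightarrow> (nat \<Rightarrow> 'a) \<Rightarrow> bool" where
  "km_iteration_with_deviations T \<zeta> \<Lambda> x p v \<longleftrightarrow>
     v 0 = 0 \<and>
     (\<forall>n. p n = (1/2) *\<^sub>R ((x n + v n) + T (x n + v n)) \<and>
          x (Suc n) = (1 - \<Lambda> n) *\<^sub>R x n + \<Lambda> n *\<^sub>R (p n - v n) \<and>
          (norm (v (Suc n)))\<^sup>2 \<le>
            \<zeta> n * (\<Lambda> n * (2 - \<Lambda> n) * (2 - \<Lambda> (Suc n)) / \<Lambda> (Suc n)) *
            (norm (p n - x n + ((\<Lambda> n - 1) / (2 - \<Lambda> n)) *\<^sub>R v n))\<^sup>2)"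

text \<open>
  Every nonexpansive operator admits, for each \<open>\<gamma> > 0\<close>, a maximally monotone operator whose
  resolvent is its average with the identity.
\<close>

lemma ex_maximally_monotone_resolvent:
  fixes T :: "'a::real_inner \<Rightarrow> 'a"
  assumes T: "nonexpansive T" and g: "0 < \<gamma>"
  shows "\<exists>A. maximally_monotone A \<and>
    resolvent \<gamma> A = (\<lambda>y. {(1/2) *\<^sub>R y + (1/2) *\<^sub>R T y})"
proof -
  define J where "J y = (1/2) *\<^sub>R y + (1/2) *\<^sub>R T y" for y
  define A where "A p = {u. p = J (p + \<gamma> *\<^sub>R u)}" for p
  have firm: "0 \<le> (J z - J w) \<bullet> ((z - J z) - (w - J w))" for z w
  proof -
    define a where "a = z - w"
    define b where "b = T z - T w"
    have 1: "J z - J w = (1/2) *\<^sub>R (a + b)"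
      by (simp add: J_def a_def b_def algebra_simps)
    have half: "c = (1/2) *\<^sub>R c + (1/2) *\<^sub>R c" for c :: 'a
      by (simp flip: scaleR_left_distrib)
    have "(z - J z) - (w - J w) = a - (1/2) *\<^sub>R (a + b)"
      using 1 by (simp add: a_def algebra_simps)
    also have "\<dots> = (1/2) *\<^sub>R (a - b)"
      using half[of a] by (simp add: algebra_simps)
    finally have 2: "(z - J z) - (w - J w) = (1/2) *\<^sub>R (a - b)" .
    have "norm b \<le> norm a" using T by (simp add: nonexpansive_def a_def b_def)
    then have "b \<bullet> b \<le> a \<bullet> a" by (simp add: norm_le)
    then show ?thesis unfolding 1 2
      by (simp add: inner_add_left inner_add_right inner_diff_left inner_diff_right inner_commute)
  qed
  have mono: "monotone_op A"
    unfolding monotone_op_def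
  proof (intro allI ballI)
    fix x y u v assume "u \<in> A x" "v \<in> A y"
    then have "x = J (x + \<gamma> *\<^sub>R u)" "y = J (y + \<gamma> *\<^sub>R v)" by (auto simp: A_def)
    with firm[of "x + \<gamma> *\<^sub>R u" "y + \<gamma> *\<^sub>R v"]
    have "0 \<le> (x - y) \<bullet> (\<gamma> *\<^sub>R u - \<gamma> *\<^sub>R v)" by simp
    then have "0 \<le> \<gamma> * ((x - y) \<bullet> (u - v))" by (simp add: algebra_simps)
    then show "0 \<le> (x - y) \<bullet> (u - v)" using g by (simp add: zero_le_mult_iff)
  qed
  have max: "B = A" if B: "monotone_op B" and sub: "\<forall>x. A x \<subseteq> B x" for B
  proof -
    have "u \<in> A x" if u: "u \<in> B x" for x u
    proof -
      define z where "z = x + \<gamma> *\<^sub>R u"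
      define w where "w = (1/\<gamma>) *\<^sub>R (z - J z)"
      have "w \<in> A (J z)" using g by (simp add: A_def w_def)
      then have "0 \<le> (x - J z) \<bullet> (u - w)"
        using B sub u unfolding monotone_op_def by blast
      moreover have "u - w = - (1/\<gamma>) *\<^sub>R (x - J z)"
        using g by (simp add: w_def z_def algebra_simps)
      ultimately have "0 \<le> - ((x - J z) \<bullet> (x - J z) / \<gamma>)" by simp
      then have "(x - J z) \<bullet> (x - J z) \<le> 0" using g by (simp add: divide_le_0_iff)
      then have "x = J z" by (metis inner_ge_zero inner_eq_zero_iff order_antisym right_minus_eq)
      then show ?thesis by (simp add: A_def z_def)
    qed
    with sub show ?thesis by blast
  qed
  have "resolvent \<gamma> A y = {J y}" for y
  proof -
    have "J y \<in> resolvent \<gamma> A y"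
      using g unfolding resolvent_def inverse_op_def A_def
      by (auto intro!: exI[of _ "(1/\<gamma>) *\<^sub>R (y - J y)"])
    then show ?thesis by (auto simp: resolvent_def inverse_op_def A_def)
  qed
  with mono max show ?thesis
    unfolding maximally_monotone_def J_def by blast
qed

end

theory Submission
  imports Defs
begin

text \<open>
  Write \<open>J = (Id + T)/2\<close>, \<open>w\<^sub>n = p\<^sub>n - x\<^sub>n - v\<^sub>n\<close> and \<open>u\<^sub>n = w\<^sub>n + v\<^sub>n / (2 - \<lambda>\<^sub>n)\<close>, the vector in the norm
  bound.  Firm nonexpansiveness of \<open>J\<close> and completing the square give, for a fixed point \<open>q\<close>,
  \<open>\<parallel>x\<^sub>n\<^sub>+\<^sub>1 - q\<parallel>\<^sup>2 + a\<^sub>n \<le> \<parallel>x\<^sub>n - q\<parallel>\<^sup>2 + b\<^sub>n\<close>, where \<open>a\<^sub>n = \<lambda>\<^sub>n (2 - \<lambda>\<^sub>n) \<parallel>u\<^sub>n\<parallel>\<^sup>2\<close> and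
  \<open>b\<^sub>n = \<lambda>\<^sub>n / (2 - \<lambda>\<^sub>n) \<parallel>v\<^sub>n\<parallel>\<^sup>2\<close>.  The norm bound says \<open>b\<^sub>n\<^sub>+\<^sub>1 \<le> \<zeta>\<^sub>n a\<^sub>n\<close>, so \<open>\<parallel>x\<^sub>n - q\<parallel>\<^sup>2 + b\<^sub>n\<close> decreases by
  at least \<open>\<epsilon> a\<^sub>n\<close>.  Hence \<open>\<parallel>x\<^sub>n - q\<parallel>\<close> converges and \<open>x\<^sub>n - T x\<^sub>n\<close> tends to \<open>0\<close>.

  Weak convergence is then obtained from asymptotic centers instead of weak compactness:
  the asymptotic center of \<open>x\<close> along any filter finer than \<open>sequentially\<close> is a fixed point, and all
  of these coincide because on fixed points the asymptotic radius does not depend on the filter.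
\<close>

section \<open>Squared-norm identities and asymptotic centers along a filter\<close>

text \<open>The parallelogram law in the form that expresses uniform convexity: a midpoint beats the
  average of its endpoints by a quarter of their squared distance.\<close>

lemma norm_sq_midpoint:
  fixes a b y :: "'a::real_inner"
  shows "(norm (y - (1/2) *\<^sub>R (a + b)))\<^sup>2
    = ((norm (y - a))\<^sup>2 + (norm (y - b))\<^sup>2) / 2 - (norm (a - b))\<^sup>2 / 4"
  by (simp add: power2_norm_eq_inner inner_add_left inner_add_right inner_diff_left
      inner_diff_right inner_commute field_simps)

lemma norm_sq_add_scaleR:
  fixes a b :: "'a::real_inner"
  shows "(norm (a + t *\<^sub>R b))\<^sup>2 = (norm a)\<^sup>2 + 2 * t * (a \<bullet> b) + t\<^sup>2 * (norm b)\<^sup>2"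
  unfolding power2_norm_eq_inner inner_add_left inner_add_right
  by (simp add: inner_commute power2_eq_square)

text \<open>
  Here \<open>\<rho>\<close> is the square of the asymptotic radius.  The second clause is minimality in the
  strong form given by uniform convexity; the constant \<open>1/2\<close> is the one that midpoints yield.
\<close>

definition asymptotic_center :: "'i filter \<Rightarrow> ('i \<Rightarrow> 'a::real_inner) \<Rightarrow> 'a \<Rightarrow> real \<Rightarrow> bool" where
  "asymptotic_center F y z \<rho> \<longleftrightarrow>
     (\<forall>e>0. \<forall>\<^sub>F n in F. (norm (y n - z))\<^sup>2 \<le> \<rho> + e) \<and>
     (\<forall>w c. (\<forall>\<^sub>F n in F. (norm (y n - w))\<^sup>2 \<le> c) \<longrightarrow> \<rho> + (norm (w - z))\<^sup>2 / 2 \<le> c)"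

text \<open>Almost optimal points are close to each other, since otherwise their midpoint would beat
  the infimum. A minimizing sequence is therefore Cauchy, and its limit is the center.\<close>

lemma asymptotic_center_exists:
  fixes y :: "'i \<Rightarrow> 'a::{real_inner, complete_space}"
  assumes F: "F \<noteq> bot" and bdd: "\<forall>\<^sub>F n in F. (norm (y n - w0))\<^sup>2 \<le> c0"
  shows "\<exists>z \<rho>. asymptotic_center F y z \<rho>"
proof -
  \<comment> \<open>Taking the infimum over points and eventual bounds together yields the least
    upper limit of the squared distances without forming upper limits.\<close>
  define C where "C = {c. \<exists>w. \<forall>\<^sub>F n in F. (norm (y n - w))\<^sup>2 \<le> c}"
  define \<rho> where "\<rho> = Inf C"
  have C_nonneg: "0 \<le> c" if "c \<in> C" for c
  proof -
    obtain w where "\<forall>\<^sub>F n in F. (norm (y n - w))\<^sup>2 \<le> c" using \<open>c \<in> C\<close> unfolding C_def by blast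
    then obtain n where "(norm (y n - w))\<^sup>2 \<le> c" using F eventually_happens' by blast
    then show ?thesis using zero_le_power2 order_trans by blast
  qed
  have ne: "C \<noteq> {}" using bdd by (auto simp: C_def)
  have \<rho>_le: "\<rho> \<le> c" if "\<forall>\<^sub>F n in F. (norm (y n - w))\<^sup>2 \<le> c" for w c
    unfolding \<rho>_def using that C_nonneg
    by (intro cInf_lower) (auto simp: C_def bdd_below_def)
  have gap: "\<rho> + (norm (a - b))\<^sup>2 / 4 \<le> (s + t) / 2"
    if "\<forall>\<^sub>F n in F. (norm (y n - a))\<^sup>2 \<le> s" "\<forall>\<^sub>F n in F. (norm (y n - b))\<^sup>2 \<le> t" for a b s t
  proof -
    have "\<forall>\<^sub>F n in F. (norm (y n - (1/2) *\<^sub>R (a + b)))\<^sup>2 \<le> (s + t) / 2 - (norm (a - b))\<^sup>2 / 4"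
      using that by eventually_elim (simp add: norm_sq_midpoint)
    from \<rho>_le[OF this] show ?thesis by linarith
  qed
  have "\<exists>w. \<forall>\<^sub>F n in F. (norm (y n - w))\<^sup>2 \<le> \<rho> + e" if "0 < e" for e
  proof -
    obtain c where "c \<in> C" "c < \<rho> + e"
      using cInf_lessD[OF ne, of "\<rho> + e"] \<open>0 < e\<close> by (auto simp: \<rho>_def)
    then obtain w where "\<forall>\<^sub>F n in F. (norm (y n - w))\<^sup>2 \<le> c" unfolding C_def by blast
    then have "\<forall>\<^sub>F n in F. (norm (y n - w))\<^sup>2 \<le> \<rho> + e"
      by eventually_elim (use \<open>c < \<rho> + e\<close> in simp)
    then show ?thesis by blast
  qed
  then have "\<forall>k::nat. \<exists>w. \<forall>\<^sub>F n in F. (norm (y n - w))\<^sup>2 \<le> \<rho> + inverse (real (Suc k))" by simp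
  then obtain Z where Z: "\<And>k. \<forall>\<^sub>F n in F. (norm (y n - Z k))\<^sup>2 \<le> \<rho> + inverse (real (Suc k))"
    by metis
  have "Cauchy Z"
  proof (rule metric_CauchyI)
    fix e :: real assume "0 < e"
    then have "0 < e\<^sup>2 / 4" by simp
    then obtain N where N: "inverse (real (Suc N)) < e\<^sup>2 / 4" using reals_Archimedean by blast
    have "dist (Z m) (Z n) < e" if "m \<ge> N" "n \<ge> N" for m n
    proof -
      have "inverse (real (Suc m)) \<le> inverse (real (Suc N))"
           "inverse (real (Suc n)) \<le> inverse (real (Suc N))"
        using that by (auto intro!: le_imp_inverse_le)
      then have "(norm (Z m - Z n))\<^sup>2 < e\<^sup>2" using gap[OF Z Z, of m n] N by argo
      then show ?thesis using \<open>0 < e\<close> by (simp add: dist_norm power_less_imp_less_base)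
    qed
    then show "\<exists>N. \<forall>m\<ge>N. \<forall>n\<ge>N. dist (Z m) (Z n) < e" by blast
  qed
  then obtain z where z: "Z \<longlonglongrightarrow> z" using Cauchy_convergent_iff convergent_def by blast
  have lim0: "(\<lambda>k. inverse (real (Suc k))) \<longlonglongrightarrow> 0" by (rule LIMSEQ_inverse_real_of_nat)
  \<comment> \<open>Apply \<open>gap\<close> to \<open>w\<close> and \<open>Z k\<close> and let
    \<open>k\<close> grow; clearing the mean doubles 1/4 to 1/2.\<close>
  have sep: "\<rho> + (norm (w - z))\<^sup>2 / 2 \<le> c" if "\<forall>\<^sub>F n in F. (norm (y n - w))\<^sup>2 \<le> c" for w c
  proof -
    have "\<rho> + (norm (w - Z k))\<^sup>2 / 4 \<le> (c + (\<rho> + inverse (real (Suc k)))) / 2" for k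
      using gap[OF that Z] .
    moreover have "(\<lambda>k. \<rho> + (norm (w - Z k))\<^sup>2 / 4) \<longlonglongrightarrow> \<rho> + (norm (w - z))\<^sup>2 / 4"
      by (intro tendsto_intros z) auto
    moreover have "(\<lambda>k. (c + (\<rho> + inverse (real (Suc k)))) / 2) \<longlonglongrightarrow> (c + (\<rho> + 0)) / 2"
      by (intro tendsto_intros lim0) auto
    ultimately have "\<rho> + (norm (w - z))\<^sup>2 / 4 \<le> (c + (\<rho> + 0)) / 2"
      by (intro LIMSEQ_le) auto
    then show ?thesis by simp
  qed
  have "\<forall>\<^sub>F n in F. (norm (y n - z))\<^sup>2 \<le> \<rho> + e" if "0 < e" for e
  proof -
    \<comment> \<open>The triangle inequality through \<open>Z k\<close> gives the bound
      \<open>h k\<close>. As \<open>h\<close> tends to \<open>\<rho>\<close>, a single fixed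
      \<open>k\<close> suffices for the given \<open>e\<close>.\<close>
    define h where "h k = (sqrt (\<rho> + inverse (real (Suc k))) + norm (Z k - z))\<^sup>2" for k
    have "0 \<le> \<rho>" unfolding \<rho>_def using ne C_nonneg by (intro cInf_greatest)
    have "h \<longlonglongrightarrow> (sqrt (\<rho> + 0) + norm (z - z))\<^sup>2"
      unfolding h_def by (intro tendsto_intros lim0 z)
    then have "h \<longlonglongrightarrow> \<rho>" using \<open>0 \<le> \<rho>\<close> by simp
    then have "\<forall>\<^sub>F k in sequentially. h k < \<rho> + e" using that by (simp add: order_tendstoD(2))
    then obtain k where k: "h k < \<rho> + e" using eventually_happens' sequentially_bot by blast
    show ?thesis using Z[of k]
    proof eventually_elim
      case (elim n)
      then have "norm (y n - Z k) \<le> sqrt (\<rho> + inverse (real (Suc k)))" by (simp add: real_le_rsqrt)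
      then have "norm (y n - z) \<le> sqrt (\<rho> + inverse (real (Suc k))) + norm (Z k - z)"
        using norm_triangle_ineq[of "y n - Z k" "Z k - z"] by simp
      then have "(norm (y n - z))\<^sup>2 \<le> h k" unfolding h_def by (simp add: power_mono)
      then show ?case using k by simp
    qed
  qed
  with sep show ?thesis unfolding asymptotic_center_def by blast
qed

text \<open>As \<open>y n - T (y n)\<close> vanishes and \<open>T\<close> does not increase
  distances, \<open>T z\<close> is asymptotically no farther from \<open>y n\<close> than
  \<open>z\<close> is. Strong minimality at \<open>w = T z\<close> then forces
  \<open>T z = z\<close>.\<close>

lemma asymptotic_center_fixed_point:
  assumes F: "F \<noteq> bot" and T: "nonexpansive T" and z: "asymptotic_center F y z \<rho>"
    and reg: "((\<lambda>n. y n - T (y n)) \<longlongrightarrow> 0) F"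
  shows "T z = z"
proof -
  have near: "\<forall>\<^sub>F n in F. (norm (y n - z))\<^sup>2 \<le> \<rho> + e" if "0 < e" for e
    using z that by (simp add: asymptotic_center_def)
  have "0 \<le> \<rho>"
  proof (rule field_le_epsilon)
    fix e :: real assume "0 < e"
    then obtain n where "(norm (y n - z))\<^sup>2 \<le> \<rho> + e" using near F eventually_happens' by blast
    then show "0 \<le> \<rho> + e" using zero_le_power2 order_trans by blast
  qed
  have "\<rho> + (norm (T z - z))\<^sup>2 / 2 \<le> (sqrt (\<rho> + e) + e)\<^sup>2" if "0 < e" for e
  proof -
    have "\<forall>\<^sub>F n in F. norm (y n - T (y n)) < e"
      using tendstoD[OF reg that] by (simp add: dist_norm)
    with near[OF that] have "\<forall>\<^sub>F n in F. (norm (y n - T z))\<^sup>2 \<le> (sqrt (\<rho> + e) + e)\<^sup>2"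
    proof eventually_elim
      case (elim n)
      have "norm (T (y n) - T z) \<le> norm (y n - z)" using T by (simp add: nonexpansive_def)
      also have "\<dots> \<le> sqrt (\<rho> + e)" using elim by (simp add: real_le_rsqrt)
      finally have "norm (y n - T z) \<le> sqrt (\<rho> + e) + e"
        using norm_triangle_ineq[of "y n - T (y n)" "T (y n) - T z"] elim by simp
      then show ?case by (simp add: power_mono)
    qed
    then show ?thesis using z by (simp add: asymptotic_center_def)
  qed
  then have "\<forall>\<^sub>F e in at_right 0. \<rho> + (norm (T z - z))\<^sup>2 / 2 \<le> (sqrt (\<rho> + e) + e)\<^sup>2"
    by (intro eventually_mono[OF eventually_at_right_less])
  moreover have "((\<lambda>e. (sqrt (\<rho> + e) + e)\<^sup>2) \<longlongrightarrow> (sqrt (\<rho> + 0) + 0)\<^sup>2) (at_right 0)"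
    by (intro tendsto_intros)
  ultimately have "\<rho> + (norm (T z - z))\<^sup>2 / 2 \<le> (sqrt (\<rho> + 0) + 0)\<^sup>2"
    using tendsto_lowerbound trivial_limit_at_right_real by blast
  then show ?thesis using \<open>0 \<le> \<rho>\<close> by simp
qed

lemma asymptotic_center_tendsto:
  assumes z: "asymptotic_center F y z \<rho>"
    and w: "((\<lambda>n. (norm (y n - w))\<^sup>2) \<longlongrightarrow> l) F"
  shows "\<rho> + (norm (w - z))\<^sup>2 / 2 \<le> l"
proof (rule field_le_epsilon)
  fix e :: real assume "0 < e"
  then have "\<forall>\<^sub>F n in F. (norm (y n - w))\<^sup>2 < l + e" using order_tendstoD(2)[OF w] by simp
  then have "\<forall>\<^sub>F n in F. (norm (y n - w))\<^sup>2 \<le> l + e" by eventually_elim simp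
  then show "\<rho> + (norm (w - z))\<^sup>2 / 2 \<le> l + e" using z by (simp add: asymptotic_center_def)
qed

text \<open>The reverse inequality is \<open>asymptotic_center_tendsto\<close> at
  \<open>w = z\<close>. Together they identify \<open>\<rho>\<close> with a limit of squared
  distances, which makes radii along different filters comparable.\<close>

lemma tendsto_le_asymptotic_radius:
  assumes F: "F \<noteq> bot" and z: "asymptotic_center F y z \<rho>"
    and l: "((\<lambda>n. (norm (y n - z))\<^sup>2) \<longlongrightarrow> l) F"
  shows "l \<le> \<rho>"
proof (rule field_le_epsilon)
  fix e :: real assume "0 < e"
  then have "\<forall>\<^sub>F n in F. (norm (y n - z))\<^sup>2 \<le> \<rho> + e" using z by (simp add: asymptotic_center_def)
  then show "l \<le> \<rho> + e" using tendsto_upperbound[OF l] F by simp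
qed

section \<open>Weak convergence to a fixed point, in the manner of Opial's lemma\<close>

lemma weakly_converges_fixed_point:
  fixes T :: "'a::{real_inner, complete_space} \<Rightarrow> 'a"
  assumes T: "nonexpansive T" and q: "T q = q"
    and lim: "\<And>w. T w = w \<Longrightarrow> convergent (\<lambda>n. (norm (x n - w))\<^sup>2)"
    and reg: "(\<lambda>n. x n - T (x n)) \<longlonglongrightarrow> 0"
  shows "\<exists>z. T z = z \<and> weakly_converges x z"
proof -
  define L where "L w = lim (\<lambda>n. (norm (x n - w))\<^sup>2)" for w
  have L: "((\<lambda>n. (norm (x n - w))\<^sup>2) \<longlongrightarrow> L w) F" if "T w = w" "F \<le> sequentially" for w F
    using lim[OF that(1)] that(2) tendsto_mono unfolding L_def convergent_LIMSEQ_iff by blast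
  have center: "\<exists>z \<rho>. asymptotic_center F x z \<rho> \<and> T z = z \<and> \<rho> = L z
      \<and> (\<forall>w. T w = w \<longrightarrow> L z + (norm (w - z))\<^sup>2 / 2 \<le> L w)"
    if F: "F \<noteq> bot" "F \<le> sequentially" for F
  proof -
    have "\<forall>\<^sub>F n in F. (norm (x n - q))\<^sup>2 < L q + 1"
      using order_tendstoD(2)[OF L[OF q F(2)]] by simp
    then have "\<forall>\<^sub>F n in F. (norm (x n - q))\<^sup>2 \<le> L q + 1" by eventually_elim simp
    from asymptotic_center_exists[OF F(1) this]
    obtain z \<rho> where z: "asymptotic_center F x z \<rho>" by blast
    have Tz: "T z = z"
      using asymptotic_center_fixed_point[OF F(1) T z tendsto_mono[OF F(2) reg]] .
    have ge: "\<rho> + (norm (w - z))\<^sup>2 / 2 \<le> L w" if "T w = w" for w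
      using asymptotic_center_tendsto[OF z L[OF that F(2)]] .
    have "L z \<le> \<rho>" using tendsto_le_asymptotic_radius[OF F(1) z L[OF Tz F(2)]] .
    with ge[OF Tz] have "\<rho> = L z" by simp
    then show ?thesis using z Tz ge by blast
  qed
  obtain z where z: "T z = z" "\<And>w. T w = w \<Longrightarrow> L z + (norm (w - z))\<^sup>2 / 2 \<le> L w"
    using center[of sequentially] by auto
  \<comment> \<open>A one-sided estimate is enough, because \<open>u\<close> can be replaced by
    \<open>- u\<close>.\<close>
  have below: "\<forall>\<^sub>F n in sequentially. (x n - z) \<bullet> u < \<delta>" if "0 < \<delta>" for u \<delta>
  proof (rule ccontr)
    define S where "S = {n. \<delta> \<le> (x n - z) \<bullet> u}"
    \<comment> \<open>Restricting the filter to \<open>S\<close> replaces passing to a subsequence;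
      the negated claim says exactly that the result is nontrivial.\<close>
    define F where "F = inf sequentially (principal S)"
    assume "\<not> (\<forall>\<^sub>F n in sequentially. (x n - z) \<bullet> u < \<delta>)"
    then have "F \<noteq> bot"
      by (simp add: F_def S_def trivial_limit_def eventually_inf_principal not_le)
    moreover have le: "F \<le> sequentially" by (simp add: F_def)
    ultimately obtain z' where z': "asymptotic_center F x z' (L z')" "T z' = z'"
      "L z' + (norm (z - z'))\<^sup>2 / 2 \<le> L z"
      using center[of F] z(1) by blast
    \<comment> \<open>Each center is tested against the other; adding the two inequalities cancels
      \<open>L z\<close> and \<open>L z'\<close>.\<close>
    have "(norm (z - z'))\<^sup>2 \<le> 0"
      using z'(3) z(2)[OF z'(2)] unfolding norm_minus_commute[of z' z] by linarith
    then have "z' = z" by simp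
    \<comment> \<open>Moving \<open>z\<close> by \<open>t *\<^sub>R u\<close> lowers the squared
      distance on \<open>S\<close> by at least \<open>2 * t * \<delta>\<close>, up to the quadratic
      term. This \<open>t\<close> keeps that term below \<open>t * \<delta>\<close>; the added 1
      covers \<open>u = 0\<close>.\<close>
    define t where "t = \<delta> / ((norm u)\<^sup>2 + 1)"
    have pos: "0 < (norm u)\<^sup>2 + 1" using zero_le_power2[of "norm u"] by linarith
    have t: "0 < t" using that pos by (simp add: t_def)
    have "t * ((norm u)\<^sup>2 + 1) = \<delta>" using pos by (simp add: t_def)
    then have "t * (norm u)\<^sup>2 \<le> \<delta>" using t by (simp add: distrib_left)
    then have tu: "t\<^sup>2 * (norm u)\<^sup>2 \<le> t * \<delta>"
      using mult_left_mono[of "t * (norm u)\<^sup>2" \<delta> t] t by (simp add: power2_eq_square mult.assoc)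
    have "\<forall>\<^sub>F n in F. (norm (x n - z))\<^sup>2 < L z + t * \<delta> / 2"
      using order_tendstoD(2)[OF L[OF z(1) le]] t that by simp
    moreover have "\<forall>\<^sub>F n in F. n \<in> S" by (simp add: F_def eventually_inf_principal)
    ultimately have "\<forall>\<^sub>F n in F. (norm (x n - (z + t *\<^sub>R u)))\<^sup>2 \<le> L z - t * \<delta> / 2"
    proof eventually_elim
      case (elim n)
      have "(norm (x n - (z + t *\<^sub>R u)))\<^sup>2
          = (norm (x n - z))\<^sup>2 - 2 * (t * ((x n - z) \<bullet> u)) + t\<^sup>2 * (norm u)\<^sup>2"
        using norm_sq_add_scaleR[of "x n - z" "- t" u] by (simp add: diff_diff_eq)
      moreover have "t * \<delta> \<le> t * ((x n - z) \<bullet> u)"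
        using elim(2) t by (simp add: S_def mult_left_mono)
      ultimately show ?case using elim(1) tu by linarith
    qed
    then have "L z + (norm (z + t *\<^sub>R u - z))\<^sup>2 / 2 \<le> L z - t * \<delta> / 2"
      using z'(1) unfolding \<open>z' = z\<close> asymptotic_center_def by blast
    moreover have "0 < t * \<delta>" using t that by simp
    ultimately show False using zero_le_power2[of "norm (z + t *\<^sub>R u - z)"] by linarith
  qed
  have "(\<lambda>n. x n \<bullet> u) \<longlonglongrightarrow> z \<bullet> u" for u
  proof (rule tendstoI)
    fix e :: real assume "0 < e"
    from below[OF this, of u] below[OF this, of "- u"]
    show "\<forall>\<^sub>F n in sequentially. dist (x n \<bullet> u) (z \<bullet> u) < e"
      by eventually_elim (simp add: dist_real_def inner_diff_left)
  qed
  with z(1) show ?thesis by (auto simp: weakly_converges_def)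
qed

section \<open>Null sequences and the energy estimate for one relaxed step\<close>

lemma tendsto_zero_norm_sq_weighted:
  fixes y :: "nat \<Rightarrow> 'a::real_normed_vector"
  assumes c: "0 < c" "\<And>n. c \<le> k n" and lim: "(\<lambda>n. k n * (norm (y n))\<^sup>2) \<longlonglongrightarrow> 0"
  shows "y \<longlonglongrightarrow> 0"
proof -
  have "(\<lambda>n. c * (norm (y n))\<^sup>2) \<longlonglongrightarrow> 0"
    by (rule Lim_null_comparison[OF _ lim]) (use c in \<open>simp add: abs_mult mult_right_mono\<close>)
  then have "(\<lambda>n. (norm (y n))\<^sup>2) \<longlonglongrightarrow> 0" using c by (simp add: tendsto_mult_left_iff)
  then show ?thesis by (simp add: tendsto_norm_zero_iff)
qed

lemma decrease_tendsto_zero: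
  fixes D a :: "nat \<Rightarrow> real"
  assumes "\<And>n. 0 \<le> D n" "\<And>n. 0 \<le> a n" "0 < \<epsilon>" and dec: "\<And>n. D (Suc n) + \<epsilon> * a n \<le> D n"
  shows "convergent D" "a \<longlonglongrightarrow> 0"
proof -
  have "decseq D"
  proof (rule decseq_SucI)
    fix n
    have "0 \<le> \<epsilon> * a n" using assms by simp
    then show "D (Suc n) \<le> D n" using dec[of n] by linarith
  qed
  then obtain l where l: "D \<longlonglongrightarrow> l" using decseq_convergent assms(1) by metis
  then show "convergent D" by (auto simp: convergent_def)
  have "(\<lambda>n. D n - D (Suc n)) \<longlonglongrightarrow> l - l" by (intro tendsto_diff l LIMSEQ_Suc)
  then have "(\<lambda>n. D n - D (Suc n)) \<longlonglongrightarrow> 0" by simp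
  then have "(\<lambda>n. \<epsilon> * a n) \<longlonglongrightarrow> 0"
  proof (rule Lim_null_comparison[rotated])
    show "\<forall>\<^sub>F n in sequentially. norm (\<epsilon> * a n) \<le> D n - D (Suc n)"
    proof (intro always_eventually allI)
      fix n
      have "0 \<le> \<epsilon> * a n" using assms by simp
      then show "norm (\<epsilon> * a n) \<le> D n - D (Suc n)" using dec[of n] by simp
    qed
  qed
  then show "a \<longlonglongrightarrow> 0" using assms(3) by (simp add: tendsto_mult_left_iff)
qed

text \<open>With \<open>a = y - q\<close> and \<open>b = T y - q\<close>, the inner product is a
  quarter of \<open>b \<bullet> b - a \<bullet> a\<close>, which nonexpansiveness makes
  nonpositive.\<close>

lemma half_averaged_inner:
  fixes T :: "'a::real_inner \<Rightarrow> 'a"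
  assumes T: "nonexpansive T" and q: "T q = q" and r: "r = (1/2) *\<^sub>R (y + T y)"
  shows "(r - q) \<bullet> (r - y) \<le> 0"
proof -
  define a where "a = y - q"
  define b where "b = T y - q"
  have "norm b \<le> norm a" using T q unfolding nonexpansive_def a_def b_def by metis
  then have "b \<bullet> b \<le> a \<bullet> a" by (simp add: norm_le)
  have half: "c = (1/2) *\<^sub>R c + (1/2) *\<^sub>R c" for c :: 'a
    by (simp flip: scaleR_left_distrib)
  have "r - q = (1/2) *\<^sub>R (a + b)" using half[of q] by (simp add: r a_def b_def algebra_simps)
  moreover have "r - y = (1/2) *\<^sub>R (b - a)"
    using half[of y] by (simp add: r a_def b_def algebra_simps)
  ultimately show ?thesis using \<open>b \<bullet> b \<le> a \<bullet> a\<close>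
    by (simp add: inner_add_left inner_add_right inner_diff_left inner_diff_right inner_commute)
qed

lemma relaxed_step_energy:
  fixes x v p q :: "'a::real_inner"
  assumes mono: "(p - q) \<bullet> (p - (x + v)) \<le> 0" and l: "0 < l" "l < 2"
  shows "(norm ((1 - l) *\<^sub>R x + l *\<^sub>R (p - v) - q))\<^sup>2
      + l * (2 - l) * (norm (p - x + ((l - 1) / (2 - l)) *\<^sub>R v))\<^sup>2
    \<le> (norm (x - q))\<^sup>2 + l / (2 - l) * (norm v)\<^sup>2"
proof -
  define w where "w = p - x - v"
  \<comment> \<open>This \<open>k\<close> completes the square: the cross term of
    \<open>l * (2 - l) * (norm (w + k *\<^sub>R v))\<^sup>2\<close> becomes
    \<open>2 * l * (v \<bullet> w)\<close>, matching the one from monotonicity, and only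
    \<open>l * k * (v \<bullet> v)\<close> is left over.\<close>
  define k where "k = 1 / (2 - l)"
  have k: "(2 - l) * k = 1" using l by (simp add: k_def)
  have "(l - 1) / (2 - l) = k - 1" using l by (simp add: k_def field_simps)
  then have u: "p - x + ((l - 1) / (2 - l)) *\<^sub>R v = w + k *\<^sub>R v"
    by (simp add: w_def scaleR_left_diff_distrib)
  have nxt: "(1 - l) *\<^sub>R x + l *\<^sub>R (p - v) - q = (x - q) + l *\<^sub>R w"
    by (simp add: w_def algebra_simps)
  have "(p - q) \<bullet> w = (x - q) \<bullet> w + w \<bullet> w + v \<bullet> w"
    by (simp add: w_def inner_add_left inner_diff_left algebra_simps)
  moreover have "(p - q) \<bullet> w \<le> 0" using mono by (simp add: w_def algebra_simps)
  ultimately have "2 * l * ((x - q) \<bullet> w + w \<bullet> w + v \<bullet> w) \<le> 0"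
    using l by (simp add: mult_nonneg_nonpos)
  moreover have "(norm ((x - q) + l *\<^sub>R w))\<^sup>2
      = (norm (x - q))\<^sup>2 + 2 * l * ((x - q) \<bullet> w) + l\<^sup>2 * (w \<bullet> w)"
    by (simp add: norm_sq_add_scaleR power2_norm_eq_inner[of w])
  ultimately have 1: "(norm ((x - q) + l *\<^sub>R w))\<^sup>2
      \<le> (norm (x - q))\<^sup>2 - 2 * l * (w \<bullet> w) - 2 * l * (v \<bullet> w) + l\<^sup>2 * (w \<bullet> w)"
    by (simp add: distrib_left)
  have "l * (2 - l) * (norm (w + k *\<^sub>R v))\<^sup>2
      = l * (2 - l) * (w \<bullet> w) + 2 * l * ((2 - l) * k) * (v \<bullet> w) + l * ((2 - l) * k) * k * (v \<bullet> v)"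
    unfolding norm_sq_add_scaleR power2_norm_eq_inner
    by (simp add: inner_commute power2_eq_square algebra_simps)
  then have 2: "l * (2 - l) * (norm (w + k *\<^sub>R v))\<^sup>2
      = l * (2 - l) * (w \<bullet> w) + 2 * l * (v \<bullet> w) + l * k * (v \<bullet> v)"
    by (simp only: k mult_1_right)
  have "l / (2 - l) * (norm v)\<^sup>2 = l * k * (v \<bullet> v)" by (simp add: k_def power2_norm_eq_inner)
  with 1 2 show ?thesis unfolding u nxt by (simp add: algebra_simps power2_eq_square)
qed

section \<open>Lyapunov argument for the iteration with deviations\<close>

theorem corollary2:
  fixes T :: "'a::{real_inner, complete_space} \<Rightarrow> 'a"
    and A :: "'a \<Rightarrow> 'a set"
    and \<gamma> \<epsilon> :: real
    and \<zeta> \<Lambda> :: "nat \<Rightarrow> real"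
    and x p v :: "nat \<Rightarrow> 'a"
  assumes "nonexpansive T"
    and "{y. y = T y} \<noteq> {}"
    and "0 < \<gamma>"
    and "maximally_monotone A"
    and "resolvent \<gamma> A = (\<lambda>y. {(1/2) *\<^sub>R y + (1/2) *\<^sub>R T y})"
    and "0 < \<epsilon>" and "\<epsilon> < 1"
    and "\<And>n. 0 \<le> \<zeta> n \<and> \<zeta> n \<le> 1 - \<epsilon>"
    and "\<And>n. \<epsilon> \<le> \<Lambda> n \<and> \<Lambda> n \<le> 2 - \<epsilon> / 2"
    and "km_iteration_with_deviations T \<zeta> \<Lambda> x p v"
  shows "\<exists>z. z = T z \<and> weakly_converges x z"
proof -
  note T = assms(1) and eps = assms(6,7)
  have zeta: "0 \<le> \<zeta> n" "\<zeta> n \<le> 1 - \<epsilon>" and lam: "\<epsilon> \<le> \<Lambda> n" "\<Lambda> n \<le> 2 - \<epsilon> / 2" for n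
    using assms(8,9) by auto
  have lam_pos: "0 < \<Lambda> n" and lam_lt: "\<epsilon> / 2 \<le> 2 - \<Lambda> n" "\<Lambda> n < 2" for n
    using lam[of n] eps by auto
  obtain q where "q = T q" using assms(2) by blast
  then have q: "T q = q" by simp
  define w where "w n = p n - (x n + v n)" for n
  define u where "u n = p n - x n + ((\<Lambda> n - 1) / (2 - \<Lambda> n)) *\<^sub>R v n" for n
  define a where "a n = \<Lambda> n * (2 - \<Lambda> n) * (norm (u n))\<^sup>2" for n
  define b where "b n = \<Lambda> n / (2 - \<Lambda> n) * (norm (v n))\<^sup>2" for n
  have p: "p n = (1/2) *\<^sub>R ((x n + v n) + T (x n + v n))"
    and x: "x (Suc n) = (1 - \<Lambda> n) *\<^sub>R x n + \<Lambda> n *\<^sub>R (p n - v n)"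
    and v: "(norm (v (Suc n)))\<^sup>2 \<le>
      \<zeta> n * (\<Lambda> n * (2 - \<Lambda> n) * (2 - \<Lambda> (Suc n)) / \<Lambda> (Suc n)) * (norm (u n))\<^sup>2" for n
    using assms(10) unfolding km_iteration_with_deviations_def u_def by blast+
  have a_nonneg: "0 \<le> a n" and b_nonneg: "0 \<le> b n" for n
    using lam_pos[of n] lam_lt[of n] by (auto simp: a_def b_def)
  \<comment> \<open>The weight in \<open>b (Suc n)\<close> is the reciprocal of the factor with
    \<open>\<Lambda> (Suc n)\<close> in the norm bound, so both cancel.\<close>
  have b_Suc: "b (Suc n) \<le> (1 - \<epsilon>) * a n" for n
  proof -
    have "b (Suc n) \<le> \<Lambda> (Suc n) / (2 - \<Lambda> (Suc n)) *
        (\<zeta> n * (\<Lambda> n * (2 - \<Lambda> n) * (2 - \<Lambda> (Suc n)) / \<Lambda> (Suc n)) * (norm (u n))\<^sup>2)"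
      unfolding b_def using v[of n] lam_pos[of "Suc n"] lam_lt(2)[of "Suc n"]
      by (intro mult_left_mono) auto
    also have "\<dots> = \<zeta> n * a n"
      using lam_pos[of "Suc n"] lam_lt(2)[of "Suc n"] by (simp add: a_def)
    also have "\<dots> \<le> (1 - \<epsilon>) * a n" using zeta a_nonneg by (intro mult_right_mono)
    finally show ?thesis .
  qed
  \<comment> \<open>Lyapunov function: including \<open>b n\<close> lets \<open>a n\<close> from one
    step pay for the deviation in the next.\<close>
  define D where "D r n = (norm (x n - r))\<^sup>2 + b n" for r n
  have D_nonneg: "0 \<le> D r n" for r n using b_nonneg by (simp add: D_def)
  have D_Suc: "D r (Suc n) + \<epsilon> * a n \<le> D r n" if r: "T r = r" for r n
  proof -
    have "(norm (x (Suc n) - r))\<^sup>2 + a n \<le> (norm (x n - r))\<^sup>2 + b n"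
      using relaxed_step_energy[OF half_averaged_inner[OF T r p[of n]] lam_pos[of n] lam_lt(2)[of n]]
      unfolding x a_def b_def u_def .
    then show ?thesis using b_Suc[of n] by (simp add: D_def algebra_simps)
  qed
  have a0: "a \<longlonglongrightarrow> 0"
    by (rule decrease_tendsto_zero(2)[where D = "D q", OF D_nonneg a_nonneg eps(1) D_Suc[OF q]])
  \<comment> \<open>\<open>b_Suc\<close> bounds only successor terms, hence the shift.\<close>
  have "(\<lambda>n. b (Suc n)) \<longlonglongrightarrow> 0"
  proof (rule tendsto_sandwich[OF _ _ tendsto_const])
    show "(\<lambda>n. (1 - \<epsilon>) * a n) \<longlonglongrightarrow> 0" using tendsto_mult_right_zero[OF a0] .
  qed (use b_nonneg b_Suc in auto)
  then have b0: "b \<longlonglongrightarrow> 0" by (rule LIMSEQ_imp_Suc)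
  have conv: "convergent (\<lambda>n. (norm (x n - r))\<^sup>2)" if r: "T r = r" for r
  proof -
    have "convergent (D r)"
      by (rule decrease_tendsto_zero(1)[where D = "D r", OF D_nonneg a_nonneg eps(1) D_Suc[OF r]])
    moreover have "convergent b" using b0 by (auto simp: convergent_def)
    ultimately have "convergent (\<lambda>n. D r n - b n)" by (rule convergent_diff)
    then show ?thesis by (simp add: D_def)
  qed
  have v0: "v \<longlonglongrightarrow> 0"
  proof (rule tendsto_zero_norm_sq_weighted)
    show "\<epsilon> / 2 \<le> \<Lambda> n / (2 - \<Lambda> n)" for n
      using lam[of n] lam_pos[of n] lam_lt(2)[of n] eps by (intro frac_le) auto
    show "(\<lambda>n. \<Lambda> n / (2 - \<Lambda> n) * (norm (v n))\<^sup>2) \<longlonglongrightarrow> 0" using b0 by (simp only: b_def[abs_def])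
  qed (use eps in simp)
  have u0: "u \<longlonglongrightarrow> 0"
  proof (rule tendsto_zero_norm_sq_weighted)
    show "\<epsilon> * (\<epsilon> / 2) \<le> \<Lambda> n * (2 - \<Lambda> n)" for n
      using lam[of n] lam_pos[of n] lam_lt[of n] eps by (intro mult_mono) auto
    show "(\<lambda>n. \<Lambda> n * (2 - \<Lambda> n) * (norm (u n))\<^sup>2) \<longlonglongrightarrow> 0" using a0 by (simp only: a_def[abs_def])
  qed (use eps in simp)
  have "(\<lambda>n. (1 / (2 - \<Lambda> n)) *\<^sub>R v n) \<longlonglongrightarrow> 0"
  proof (rule Lim_null_comparison)
    show "(\<lambda>n. 1 / (\<epsilon> / 2) * norm (v n)) \<longlonglongrightarrow> 0"
      by (rule tendsto_mult_right_zero[OF tendsto_norm_zero[OF v0]])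
    show "\<forall>\<^sub>F n in sequentially. norm ((1 / (2 - \<Lambda> n)) *\<^sub>R v n) \<le> 1 / (\<epsilon> / 2) * norm (v n)"
    proof (intro always_eventually allI)
      fix n
      have "1 / (2 - \<Lambda> n) \<le> 1 / (\<epsilon> / 2)" using lam_lt[of n] eps by (intro frac_le) auto
      then have "1 / (2 - \<Lambda> n) * norm (v n) \<le> 1 / (\<epsilon> / 2) * norm (v n)"
        by (rule mult_right_mono) simp
      then show "norm ((1 / (2 - \<Lambda> n)) *\<^sub>R v n) \<le> 1 / (\<epsilon> / 2) * norm (v n)"
        using lam_lt(2)[of n] by simp
    qed
  qed
  from tendsto_diff[OF u0 this] have "(\<lambda>n. u n - (1 / (2 - \<Lambda> n)) *\<^sub>R v n) \<longlonglongrightarrow> 0" by simp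
  moreover have "u n - (1 / (2 - \<Lambda> n)) *\<^sub>R v n = w n" for n
  proof -
    have "(\<Lambda> n - 1) / (2 - \<Lambda> n) = 1 / (2 - \<Lambda> n) - 1" using lam_lt(2)[of n] by (simp add: field_simps)
    then show ?thesis by (simp add: u_def w_def scaleR_left_diff_distrib)
  qed
  ultimately have w0: "w \<longlonglongrightarrow> 0" by simp
  have "(\<lambda>n. x n - T (x n)) \<longlonglongrightarrow> 0"
  proof (rule Lim_null_comparison)
    show "(\<lambda>n. 2 * norm (w n) + 2 * norm (v n)) \<longlonglongrightarrow> 0"
      using tendsto_add[OF tendsto_mult_right_zero[OF tendsto_norm_zero[OF w0]]
          tendsto_mult_right_zero[OF tendsto_norm_zero[OF v0]]] by simp
    show "\<forall>\<^sub>F n in sequentially. norm (x n - T (x n)) \<le> 2 * norm (w n) + 2 * norm (v n)"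
    proof (intro always_eventually allI)
      fix n
      \<comment> \<open>\<open>p n\<close> is the midpoint of \<open>x n + v n\<close> and its
        image, so \<open>T\<close> displaces \<open>x n + v n\<close> by
        \<open>2 *\<^sub>R w n\<close>. Returning to \<open>x n\<close> costs
        \<open>norm (v n)\<close> twice, once directly and once through \<open>T\<close>.\<close>
      have "T (x n + v n) = 2 *\<^sub>R p n - (x n + v n)" by (simp add: p)
      then have "T (x n + v n) - (x n + v n) = 2 *\<^sub>R w n" by (simp add: w_def algebra_simps scaleR_2)
      then have "norm (T (x n + v n) - (x n + v n)) = 2 * norm (w n)" by simp
      moreover have "norm (T (x n + v n) - T (x n)) \<le> norm (v n)"
        using T unfolding nonexpansive_def by (metis add_diff_cancel_left')
      moreover have "norm (x n - T (x n))
          = norm ((T (x n + v n) - T (x n)) - v n - (T (x n + v n) - (x n + v n)))" by simp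
      ultimately show "norm (x n - T (x n)) \<le> 2 * norm (w n) + 2 * norm (v n)"
        using norm_triangle_ineq4[of "(T (x n + v n) - T (x n)) - v n" "T (x n + v n) - (x n + v n)"]
          norm_triangle_ineq4[of "T (x n + v n) - T (x n)" "v n"] by linarith
    qed
  qed
  from weakly_converges_fixed_point[OF T q conv this]
  obtain z where "T z = z" "weakly_converges x z" by blast
  then show ?thesis by (intro exI[of _ z]) simp
qed

end
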